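(* Let $p$ be a prime. The additive group $\mathbb{Z}_p$ of $p$-adic integers is natural if and only if $p$ is odd.
   Context: A group $(G,* )$ is called natural if there exists a metric $d$ on the underlying set $G$ such that (i) every right translation $R_g: x \mapsto x*g$, $g \in G$, is an isometry of $(G,d)$, and (ii) whenever $(G,\circ)$ is any group structure on the same set $G$ all of whose right translations are isometries of $(G,d)$, then $(G,\circ)$ is isomorphic to $(G,* )$ as an abstract group. The metric $d$ is arbitrary; in particular it need not be the $p$-adic metric nor induce the $p$-adic topology. *)

theory Defs
  imports "HOL-Algebra.Group" "HOL-Analysis.Abstract_Metric_Spaces"
    "HOL-Computational_Algebra.Primes"
begin

definition isometry_of :: "'a set \<Rightarrow> ('a \<Rightarrow> 'a \<Rightarrow> real) \<Rightarrow> ('a \<Rightarrow> 'a) \<Rightarrow> bool" where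
  "isometry_of M d f \<longleftrightarrow>
     bij_betw f M M \<and> (\<forall>x\<in>M. \<forall>y\<in>M. d (f x) (f y) = d x y)"

definition right_translations_isometric :: "'a monoid \<Rightarrow> ('a \<Rightarrow> 'a \<Rightarrow> real) \<Rightarrow> bool" where
  "right_translations_isometric G d \<longleftrightarrow>
     (\<forall>g\<in>carrier G. isometry_of (carrier G) d (\<lambda>x. x \<otimes>\<^bsub>G\<^esub> g))"

(* The locale Metric_space also asks for symmetry and nonnegativity of d outside its
   carrier. This is no restriction: replacing d by 0 off the carrier affects nothing else. *)
definition natural_group :: "'a monoid \<Rightarrow> bool" where
  "natural_group G \<longleftrightarrow> group G \<and>
     (\<exists>d. Metric_space (carrier G) d \<and>
          right_translations_isometric G d \<and>
          (\<forall>H :: 'a monoid. group H \<longrightarrow> carrier H = carrier G \<longrightarrow>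
               right_translations_isometric H d \<longrightarrow> H \<cong> G))"

(* The inverse limit of the groups Z/p^n along the reduction maps, each class modulo p^n
   being represented by its residue in {0..<p^n}. *)
definition padic_int_group :: "nat \<Rightarrow> (nat \<Rightarrow> int) monoid" where
  "padic_int_group p =
     \<lparr>carrier = {x. \<forall>n. x n \<in> {0..<int p ^ n} \<and> x (Suc n) mod int p ^ n = x n},
      monoid.mult = (\<lambda>x y n. (x n + y n) mod int p ^ n),
      one = (\<lambda>n. 0)\<rparr>"

lemma comm_group_padic_int_group:
  assumes "p > 0"
  shows "comm_group (padic_int_group p)"
proof -
  have pos: "int p ^ n > 0" for n using assms by simp
  have red: "a mod int p ^ Suc n mod int p ^ n = a mod int p ^ n" for a n
    by (rule mod_mod_cancel) simp
  show ?thesis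
  proof (rule comm_groupI, goal_cases)
    case (1 x y)
    then have *: "x (Suc n) mod int p ^ n = x n" "y (Suc n) mod int p ^ n = y n" for n
      by (auto simp: padic_int_group_def)
    have "(x (Suc n) + y (Suc n)) mod int p ^ Suc n mod int p ^ n = (x n + y n) mod int p ^ n" for n
      unfolding red by (metis * mod_add_eq)
    then show ?case using pos by (auto simp: padic_int_group_def simp del: power_Suc)
  next
    case 2
    then show ?case using assms by (auto simp: padic_int_group_def)
  next
    case (3 x y z)
    then show ?case by (auto simp: padic_int_group_def mod_simps add.assoc)
  next
    case (4 x y)
    then show ?case by (auto simp: padic_int_group_def add.commute)
  next
    case (5 x)
    then show ?case by (auto simp: padic_int_group_def)
  next
    case (6 x)
    define y where "y = (\<lambda>n. (- x n) mod int p ^ n)"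
    have *: "x (Suc n) mod int p ^ n = x n" for n
      using 6 by (auto simp: padic_int_group_def)
    have "(- x (Suc n)) mod int p ^ Suc n mod int p ^ n = (- x n) mod int p ^ n" for n
      unfolding red by (metis * mod_minus_eq)
    then have "y \<in> carrier (padic_int_group p)"
      using pos by (auto simp: padic_int_group_def y_def simp del: power_Suc)
    moreover have "y \<otimes>\<^bsub>padic_int_group p\<^esub> x = \<one>\<^bsub>padic_int_group p\<^esub>"
      by (auto simp: padic_int_group_def y_def mod_simps)
    ultimately show ?case by blast
  qed
qed

end

theory Submission
  imports Defs
begin

text \<open>
  A right-invariant metric on an abelian group is automatically invariant under inversion, so
  besides the translations \<open>x \<mapsto> x + g\<close> its isometries include the reflections \<open>x \<mapsto> g - x\<close>. The right
  translations of a competing group structure form a group of isometries that acts simply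
  transitively on the underlying set. Naturality therefore hinges on whether such a group can
  use reflections, and hence on whether reflections have fixed points: \<open>x \<mapsto> g - x\<close> fixes \<open>x\<close>
  exactly when \<open>2x = g\<close>.

  For odd \<open>p\<close> every \<open>p\<close>-adic integer has a unique half. A metric whose distances determine the
  difference of two points up to sign has no isometries other than translations and reflections
  (\<open>translation_or_reflection\<close>), and one exists because there are only continuum many points
  (\<open>ex_generic_invariant_metric\<close>). Since each reflection fixes a point, a competing group consists
  of translations alone and is isomorphic to the original one
  (\<open>natural_group_if_uniquely_2_divisible\<close>).

  For \<open>p = 2\<close> the reflections \<open>x \<mapsto> g - x\<close> with \<open>g\<close> odd have no fixed points. Together with the
  translations by even elements they act simply transitively and form a nonabelian group, for
  whatever metric is proposed (\<open>not_natural_group_if_index_2_subgroup\<close>).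
\<close>

section \<open>Rigidity of isometries in abelian groups without involutions\<close>

lemma (in group) right_mult_inv_right_mult:
  assumes "x \<in> carrier G" "y \<in> carrier G" "g \<in> carrier G"
  shows "x \<otimes> g \<otimes> inv (y \<otimes> g) = x \<otimes> inv y"
proof -
  have "g \<otimes> (inv g \<otimes> inv y) = inv y" using assms by (simp add: m_assoc[symmetric])
  then show ?thesis using assms by (simp add: inv_mult_group m_assoc)
qed

text \<open>
  Comparing each point with the identity shows that \<open>f\<close> acts as a translation or as a reflection at
  each single point. If both kinds were needed, at \<open>y\<close> and at \<open>x\<close> respectively, then comparing
  \<open>x\<close> with \<open>y\<close> would make one of them equal to its own inverse.
\<close>
lemma translation_or_reflection:
  assumes "comm_group G"
    and no_involution: "\<And>x. x \<in> carrier G \<Longrightarrow> x \<otimes>\<^bsub>G\<^esub> x = \<one>\<^bsub>G\<^esub> \<Longrightarrow> x = \<one>\<^bsub>G\<^esub>"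
    and f: "\<And>x. x \<in> carrier G \<Longrightarrow> f x \<in> carrier G"
    and diff: "\<And>x y. x \<in> carrier G \<Longrightarrow> y \<in> carrier G \<Longrightarrow>
      f x \<otimes>\<^bsub>G\<^esub> inv\<^bsub>G\<^esub> f y = x \<otimes>\<^bsub>G\<^esub> inv\<^bsub>G\<^esub> y \<or> f x \<otimes>\<^bsub>G\<^esub> inv\<^bsub>G\<^esub> f y = inv\<^bsub>G\<^esub> (x \<otimes>\<^bsub>G\<^esub> inv\<^bsub>G\<^esub> y)"
  shows "(\<forall>x\<in>carrier G. f x = x \<otimes>\<^bsub>G\<^esub> f \<one>\<^bsub>G\<^esub>) \<or> (\<forall>x\<in>carrier G. f x = inv\<^bsub>G\<^esub> x \<otimes>\<^bsub>G\<^esub> f \<one>\<^bsub>G\<^esub>)"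
proof (rule ccontr)
  interpret comm_group G by fact
  define a where "a = f \<one>\<^bsub>G\<^esub>"
  have a: "a \<in> carrier G" by (simp add: a_def f)
  have each: "f x = x \<otimes>\<^bsub>G\<^esub> a \<or> f x = inv\<^bsub>G\<^esub> x \<otimes>\<^bsub>G\<^esub> a" if "x \<in> carrier G" for x
    using diff[OF that one_closed] that a f[OF that] by (auto simp: a_def inv_solve_right')
  assume "\<not> ?thesis"
  then obtain x y where x: "x \<in> carrier G" "f x \<noteq> x \<otimes>\<^bsub>G\<^esub> a"
    and y: "y \<in> carrier G" "f y \<noteq> inv\<^bsub>G\<^esub> y \<otimes>\<^bsub>G\<^esub> a"
    by (auto simp: a_def)
  have fx: "f x = inv\<^bsub>G\<^esub> x \<otimes>\<^bsub>G\<^esub> a" and fy: "f y = y \<otimes>\<^bsub>G\<^esub> a" using each x y by auto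
  have "x \<noteq> \<one>\<^bsub>G\<^esub>" "y \<noteq> \<one>\<^bsub>G\<^esub>" using fx fy x y by auto
  have "f x \<otimes>\<^bsub>G\<^esub> inv\<^bsub>G\<^esub> f y = inv\<^bsub>G\<^esub> x \<otimes>\<^bsub>G\<^esub> inv\<^bsub>G\<^esub> y"
    using x y a by (simp add: fx fy right_mult_inv_right_mult)
  then consider "inv\<^bsub>G\<^esub> x \<otimes>\<^bsub>G\<^esub> inv\<^bsub>G\<^esub> y = x \<otimes>\<^bsub>G\<^esub> inv\<^bsub>G\<^esub> y"
    | "inv\<^bsub>G\<^esub> x \<otimes>\<^bsub>G\<^esub> inv\<^bsub>G\<^esub> y = inv\<^bsub>G\<^esub> x \<otimes>\<^bsub>G\<^esub> y"
    using diff[OF x(1) y(1)] x y by (auto simp: inv_mult)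
  then show False
  proof cases
    case 1
    then have "inv\<^bsub>G\<^esub> x = x" using x y by simp
    then show False using no_involution[of x] x \<open>x \<noteq> \<one>\<^bsub>G\<^esub>\<close> r_inv[of x] by simp
  next
    case 2
    then have "inv\<^bsub>G\<^esub> y = y" using x y by simp
    then show False using no_involution[of y] y \<open>y \<noteq> \<one>\<^bsub>G\<^esub>\<close> r_inv[of y] by simp
  qed
qed

section \<open>Uniquely 2-divisible groups of at most continuum size\<close>

text \<open>
  The triangle inequality is automatic when the distances between distinct points lie between 1
  and 2. So the distance may be any function of the pair \<open>{z, z\<inverse>}\<close>, where \<open>z\<close> is the difference of
  the two points, and there are enough reals for this function to be injective.
\<close>
lemma ex_generic_invariant_metric:
  assumes "comm_group G" and small: "carrier G \<lesssim> (UNIV :: real set)"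
  shows "\<exists>d. Metric_space (carrier G) d \<and>
    (\<forall>x\<in>carrier G. \<forall>y\<in>carrier G. \<forall>g\<in>carrier G. d (x \<otimes>\<^bsub>G\<^esub> g) (y \<otimes>\<^bsub>G\<^esub> g) = d x y) \<and>
    (\<forall>x\<in>carrier G. \<forall>y\<in>carrier G. \<forall>u\<in>carrier G. \<forall>v\<in>carrier G. d u v = d x y \<longrightarrow>
       u \<otimes>\<^bsub>G\<^esub> inv\<^bsub>G\<^esub> v = x \<otimes>\<^bsub>G\<^esub> inv\<^bsub>G\<^esub> y \<or> u \<otimes>\<^bsub>G\<^esub> inv\<^bsub>G\<^esub> v = inv\<^bsub>G\<^esub> (x \<otimes>\<^bsub>G\<^esub> inv\<^bsub>G\<^esub> y))"
proof -
  interpret comm_group G by fact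
  have "(UNIV :: real set) \<lesssim> {0..<1::real}" by (rule reals_lepoll_reals01)
  with small have "carrier G \<lesssim> {0..<1::real}" by (rule lepoll_trans)
  then obtain code where inj: "inj_on code (carrier G)" and code: "code ` carrier G \<subseteq> {0..<1::real}"
    by (auto simp: lepoll_def)
  \<comment> \<open>The choice depends only on the set, so an element and its inverse get the same representative.\<close>
  define rep where "rep z = (SOME r. r \<in> {z, inv\<^bsub>G\<^esub> z})" for z
  have rep_set: "rep z \<in> {z, inv\<^bsub>G\<^esub> z}" for z unfolding rep_def by (rule someI[of _ z]) simp
  have rep_inv: "rep (inv\<^bsub>G\<^esub> z) = rep z" if "z \<in> carrier G" for z
    using that by (simp add: rep_def insert_commute disj_commute)
  have rep_eqD: "z = w \<or> z = inv\<^bsub>G\<^esub> w" if "rep z = rep w" "z \<in> carrier G" "w \<in> carrier G" for z w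
    using rep_set[of z] rep_set[of w] that by (metis insertE inv_inv singletonD)
  have rep_closed: "rep z \<in> carrier G" if "z \<in> carrier G" for z
    using rep_set[of z] that by auto
  define d where "d x y = (if x \<in> carrier G \<and> y \<in> carrier G \<and> x \<noteq> y
    then 1 + code (rep (x \<otimes>\<^bsub>G\<^esub> inv\<^bsub>G\<^esub> y)) else 0)" for x y
  have d_bounds: "1 \<le> d x y" "d x y \<le> 2" if "x \<in> carrier G" "y \<in> carrier G" "x \<noteq> y" for x y
  proof -
    have "code (rep (x \<otimes>\<^bsub>G\<^esub> inv\<^bsub>G\<^esub> y)) \<in> {0..<1}"
      using rep_closed that by (intro subsetD[OF code] imageI) simp
    then show "1 \<le> d x y" "d x y \<le> 2" using that by (auto simp: d_def)
  qed
  have d_outside: "d x y = 0" if "\<not> (x \<in> carrier G \<and> y \<in> carrier G \<and> x \<noteq> y)" for x y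
    using that by (auto simp: d_def)
  have "Metric_space (carrier G) d"
  proof
    show "0 \<le> d x y" for x y using d_bounds[of x y] d_outside[of x y] by linarith
    show "d x y = d y x" for x y
    proof (cases "x \<in> carrier G \<and> y \<in> carrier G")
      case True
      then have "inv\<^bsub>G\<^esub> (x \<otimes>\<^bsub>G\<^esub> inv\<^bsub>G\<^esub> y) = y \<otimes>\<^bsub>G\<^esub> inv\<^bsub>G\<^esub> x" by (simp add: inv_mult_group)
      then show ?thesis using True rep_inv[of "x \<otimes>\<^bsub>G\<^esub> inv\<^bsub>G\<^esub> y"] by (auto simp: d_def)
    qed (auto simp: d_def)
    show "d x y = 0 \<longleftrightarrow> x = y" if "x \<in> carrier G" "y \<in> carrier G" for x y
      using d_bounds[of x y] d_outside[of x y] that by (cases "x = y") auto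
    show "d x z \<le> d x y + d y z" if "x \<in> carrier G" "y \<in> carrier G" "z \<in> carrier G" for x y z
      using d_bounds[of x y] d_bounds[of y z] d_bounds[of x z]
        d_outside[of x y] d_outside[of y z] d_outside[of x z] that
      by (cases "x = y"; cases "y = z"; cases "x = z") auto
  qed
  moreover have "d (x \<otimes>\<^bsub>G\<^esub> g) (y \<otimes>\<^bsub>G\<^esub> g) = d x y"
    if "x \<in> carrier G" "y \<in> carrier G" "g \<in> carrier G" for x y g
    using that by (simp add: d_def right_mult_inv_right_mult)
  moreover have "u \<otimes>\<^bsub>G\<^esub> inv\<^bsub>G\<^esub> v = x \<otimes>\<^bsub>G\<^esub> inv\<^bsub>G\<^esub> y \<or> u \<otimes>\<^bsub>G\<^esub> inv\<^bsub>G\<^esub> v = inv\<^bsub>G\<^esub> (x \<otimes>\<^bsub>G\<^esub> inv\<^bsub>G\<^esub> y)"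
    if eq: "d u v = d x y"
      and mem: "x \<in> carrier G" "y \<in> carrier G" "u \<in> carrier G" "v \<in> carrier G" for x y u v
  proof (cases "x = y \<or> u = v")
    case True
    then have "x = y" "u = v"
      using eq d_bounds[of x y] d_bounds[of u v] d_outside[of x y] d_outside[of u v] mem
      by (cases "x = y"; cases "u = v"; auto)+
    then show ?thesis using mem by simp
  next
    case False
    with eq mem have "code (rep (u \<otimes>\<^bsub>G\<^esub> inv\<^bsub>G\<^esub> v)) = code (rep (x \<otimes>\<^bsub>G\<^esub> inv\<^bsub>G\<^esub> y))"
      by (simp add: d_def)
    then have "rep (u \<otimes>\<^bsub>G\<^esub> inv\<^bsub>G\<^esub> v) = rep (x \<otimes>\<^bsub>G\<^esub> inv\<^bsub>G\<^esub> y)"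
      using inj_onD[OF inj] rep_closed mem by simp
    then show ?thesis using rep_eqD mem by simp
  qed
  ultimately show ?thesis by blast
qed

text \<open>
  Under a generic metric, right translation by an element \<open>g\<close> of a competing group is a translation
  or a reflection of the original group. A reflection \<open>x \<mapsto> x\<inverse> c\<close> fixes the square root of \<open>c\<close>,
  whereas the only right translation of a group with a fixed point is the identity map, which is
  also a translation. So the competing group acts by translations, and the map sending \<open>g\<close> to the
  element it translates by is an isomorphism.
\<close>
lemma natural_group_if_uniquely_2_divisible:
  fixes G :: "'a monoid"
  assumes "comm_group G" and small: "carrier G \<lesssim> (UNIV :: real set)"
    and no_involution: "\<And>x. x \<in> carrier G \<Longrightarrow> x \<otimes>\<^bsub>G\<^esub> x = \<one>\<^bsub>G\<^esub> \<Longrightarrow> x = \<one>\<^bsub>G\<^esub>"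
    and root: "\<And>c. c \<in> carrier G \<Longrightarrow> \<exists>y\<in>carrier G. y \<otimes>\<^bsub>G\<^esub> y = c"
  shows "natural_group G"
proof -
  interpret comm_group G by fact
  from ex_generic_invariant_metric[OF \<open>comm_group G\<close> small] obtain d
    where metric: "Metric_space (carrier G) d"
      and invariant: "\<And>x y g. x \<in> carrier G \<Longrightarrow> y \<in> carrier G \<Longrightarrow> g \<in> carrier G \<Longrightarrow>
        d (x \<otimes>\<^bsub>G\<^esub> g) (y \<otimes>\<^bsub>G\<^esub> g) = d x y"
      and generic: "\<And>x y u v. x \<in> carrier G \<Longrightarrow> y \<in> carrier G \<Longrightarrow> u \<in> carrier G \<Longrightarrow>
        v \<in> carrier G \<Longrightarrow> d u v = d x y \<Longrightarrow>
        u \<otimes>\<^bsub>G\<^esub> inv\<^bsub>G\<^esub> v = x \<otimes>\<^bsub>G\<^esub> inv\<^bsub>G\<^esub> y \<or> u \<otimes>\<^bsub>G\<^esub> inv\<^bsub>G\<^esub> v = inv\<^bsub>G\<^esub> (x \<otimes>\<^bsub>G\<^esub> inv\<^bsub>G\<^esub> y)"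
    by blast
  have bij_translation: "bij_betw (\<lambda>x. x \<otimes>\<^bsub>G\<^esub> g) (carrier G) (carrier G)" if "g \<in> carrier G" for g
    by (rule bij_betw_byWitness[where f' = "\<lambda>x. x \<otimes>\<^bsub>G\<^esub> inv\<^bsub>G\<^esub> g"])
      (use that in \<open>auto simp: m_assoc\<close>)
  then have isometric: "right_translations_isometric G d"
    by (simp add: right_translations_isometric_def isometry_of_def invariant)
  have iso: "H \<cong> G"
    if "group H" and carrier: "carrier H = carrier G" and isometric: "right_translations_isometric H d"
    for H :: "'a monoid"
  proof -
    interpret H: group H by fact
    note H_closed = H.m_closed[unfolded carrier] H.inv_closed[unfolded carrier]
      H.one_closed[unfolded carrier]
    define t where "t g = \<one>\<^bsub>G\<^esub> \<otimes>\<^bsub>H\<^esub> g" for g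
    have t_closed: "t g \<in> carrier G" if "g \<in> carrier G" for g
      using that by (simp add: t_def H_closed)
    have translation: "x \<otimes>\<^bsub>H\<^esub> g = x \<otimes>\<^bsub>G\<^esub> t g" if g: "g \<in> carrier G" and x: "x \<in> carrier G" for x g
    proof -
      have pres: "d (x \<otimes>\<^bsub>H\<^esub> g) (y \<otimes>\<^bsub>H\<^esub> g) = d x y" if "x \<in> carrier G" "y \<in> carrier G" for x y
        using isometric g that
        by (simp add: right_translations_isometric_def isometry_of_def carrier)
      have "(\<forall>x\<in>carrier G. x \<otimes>\<^bsub>H\<^esub> g = x \<otimes>\<^bsub>G\<^esub> t g) \<or>
          (\<forall>x\<in>carrier G. x \<otimes>\<^bsub>H\<^esub> g = inv\<^bsub>G\<^esub> x \<otimes>\<^bsub>G\<^esub> t g)"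
        unfolding t_def
        by (rule translation_or_reflection[OF \<open>comm_group G\<close> no_involution])
          (use g in \<open>simp_all add: H_closed generic pres\<close>)
      then show ?thesis
      proof
        assume reflection: "\<forall>x\<in>carrier G. x \<otimes>\<^bsub>H\<^esub> g = inv\<^bsub>G\<^esub> x \<otimes>\<^bsub>G\<^esub> t g"
        obtain y where y: "y \<in> carrier G" "y \<otimes>\<^bsub>G\<^esub> y = t g" using root t_closed g by blast
        have "y \<otimes>\<^bsub>H\<^esub> g = inv\<^bsub>G\<^esub> y \<otimes>\<^bsub>G\<^esub> (y \<otimes>\<^bsub>G\<^esub> y)" using reflection y by simp
        also have "\<dots> = y" using y(1) by (simp add: m_assoc[symmetric])
        finally have "g = \<one>\<^bsub>H\<^esub>" using H.r_cancel_one[of y g] y g carrier by simp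
        then show ?thesis using x by (simp add: t_def carrier)
      qed (use x in blast)
    qed
    have "t \<in> iso H G"
    proof (rule isoI)
      show "t \<in> hom H G"
      proof (rule homI)
        fix g k assume gk: "g \<in> carrier H" "k \<in> carrier H"
        have "t (g \<otimes>\<^bsub>H\<^esub> k) = t g \<otimes>\<^bsub>H\<^esub> k" using gk by (simp add: t_def H.m_assoc carrier)
        then show "t (g \<otimes>\<^bsub>H\<^esub> k) = t g \<otimes>\<^bsub>G\<^esub> t k" using gk by (simp add: translation t_closed carrier)
      qed (simp add: t_closed carrier)
      show "bij_betw t (carrier H) (carrier G)"
        by (rule bij_betw_byWitness[where f' = "\<lambda>x. inv\<^bsub>H\<^esub> \<one>\<^bsub>G\<^esub> \<otimes>\<^bsub>H\<^esub> x"])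
          (auto simp: t_def carrier H_closed H.m_assoc[symmetric])
    qed
    then show ?thesis by (rule is_isoI)
  qed
  show ?thesis
    unfolding natural_group_def
    by (intro conjI exI[of _ d] allI impI) (fact is_group metric isometric | rule iso; assumption)+
qed

section \<open>Abelian groups with a subgroup of index two\<close>

text \<open>
  For \<open>K\<close> of index at most two, this is the simply transitive group of translations by elements of
  \<open>K\<close> and reflections \<open>x \<mapsto> x\<inverse> g\<close> with \<open>g\<close> outside \<open>K\<close>, transported to the underlying set by
  evaluation at the identity.
\<close>
definition dihedral_twist :: "'a monoid \<Rightarrow> 'a set \<Rightarrow> 'a monoid" where
  "dihedral_twist G K = \<lparr>carrier = carrier G,
     monoid.mult = (\<lambda>x g. if g \<in> K then x \<otimes>\<^bsub>G\<^esub> g else inv\<^bsub>G\<^esub> x \<otimes>\<^bsub>G\<^esub> g),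
     one = \<one>\<^bsub>G\<^esub>\<rparr>"

text \<open>
  Associativity compares signs: the composite of two of the maps is a reflection exactly when one of
  them is, and because \<open>K\<close> has index at most two this matches membership of the product in \<open>K\<close>.
\<close>
lemma group_dihedral_twist:
  assumes "comm_group G" "subgroup K G"
    and index2: "\<And>x y. x \<in> carrier G - K \<Longrightarrow> y \<in> carrier G - K \<Longrightarrow> x \<otimes>\<^bsub>G\<^esub> y \<in> K"
  shows "group (dihedral_twist G K)"
proof -
  interpret comm_group G by fact
  interpret K: subgroup K G by fact
  have mixed: "x \<otimes>\<^bsub>G\<^esub> y \<notin> K" if "x \<in> K" "y \<in> carrier G - K" for x y
  proof
    assume "x \<otimes>\<^bsub>G\<^esub> y \<in> K"
    then have "inv\<^bsub>G\<^esub> x \<otimes>\<^bsub>G\<^esub> (x \<otimes>\<^bsub>G\<^esub> y) \<in> K" using that by blast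
    then show False using that by (simp add: m_assoc[symmetric])
  qed
  have K_mult: "x \<otimes>\<^bsub>G\<^esub> y \<in> K \<longleftrightarrow> (x \<in> K \<longleftrightarrow> y \<in> K)" if "x \<in> carrier G" "y \<in> carrier G" for x y
    using that index2[of x y] mixed[of x y] mixed[of y x] m_comm[of x y] K.m_closed[of x y] by auto
  have K_inv: "inv\<^bsub>G\<^esub> x \<in> K \<longleftrightarrow> x \<in> K" if "x \<in> carrier G" for x
    using that K.m_inv_closed[of x] K.m_inv_closed[of "inv\<^bsub>G\<^esub> x"] by auto
  let ?H = "dihedral_twist G K"
  show ?thesis
  proof (rule groupI)
    fix x assume x: "x \<in> carrier ?H"
    show "\<exists>y\<in>carrier ?H. y \<otimes>\<^bsub>?H\<^esub> x = \<one>\<^bsub>?H\<^esub>"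
      by (rule bexI[of _ "if x \<in> K then inv\<^bsub>G\<^esub> x else x"])
        (use x in \<open>auto simp: dihedral_twist_def\<close>)
  next
    fix x y z
    assume "x \<in> carrier ?H" "y \<in> carrier ?H" "z \<in> carrier ?H"
    then show "x \<otimes>\<^bsub>?H\<^esub> y \<otimes>\<^bsub>?H\<^esub> z = x \<otimes>\<^bsub>?H\<^esub> (y \<otimes>\<^bsub>?H\<^esub> z)"
      by (cases "y \<in> K"; cases "z \<in> K") (simp_all add: dihedral_twist_def K_mult K_inv inv_mult m_assoc)
  qed (simp_all add: dihedral_twist_def)
qed

text \<open>
  The twisted group acts by isometries of any right-invariant metric. In it, elements outside \<open>K\<close>
  invert \<open>K\<close> under conjugation, so it is not abelian as soon as some element of \<open>K\<close> differs from its
  inverse.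
\<close>
lemma not_natural_group_if_index_2_subgroup:
  fixes G :: "'a monoid"
  assumes "comm_group G" "subgroup K G"
    and index2: "\<And>x y. x \<in> carrier G - K \<Longrightarrow> y \<in> carrier G - K \<Longrightarrow> x \<otimes>\<^bsub>G\<^esub> y \<in> K"
    and g: "g \<in> carrier G - K" and k: "k \<in> K" "k \<otimes>\<^bsub>G\<^esub> k \<noteq> \<one>\<^bsub>G\<^esub>"
  shows "\<not> natural_group G"
proof
  interpret comm_group G by fact
  interpret K: subgroup K G by fact
  let ?H = "dihedral_twist G K"
  interpret H: group ?H by (rule group_dihedral_twist) fact+
  have carrier: "carrier ?H = carrier G" by (simp add: dihedral_twist_def)
  assume "natural_group G"
  then obtain d where metric: "Metric_space (carrier G) d"
    and isometric: "right_translations_isometric G d"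
    and unique: "\<And>H :: 'a monoid. group H \<Longrightarrow> carrier H = carrier G \<Longrightarrow>
      right_translations_isometric H d \<Longrightarrow> H \<cong> G"
    unfolding natural_group_def by blast
  interpret Metric_space "carrier G" d by (rule metric)
  have invariant: "d (x \<otimes>\<^bsub>G\<^esub> h) (y \<otimes>\<^bsub>G\<^esub> h) = d x y"
    if "x \<in> carrier G" "y \<in> carrier G" "h \<in> carrier G" for x y h
    using isometric that by (simp add: right_translations_isometric_def isometry_of_def)
  have d_inv: "d (inv\<^bsub>G\<^esub> x) (inv\<^bsub>G\<^esub> y) = d x y" if xy: "x \<in> carrier G" "y \<in> carrier G" for x y
  proof -
    \<comment> \<open>Translating by \<open>x y\<close> carries the pair of inverses to the swapped pair.\<close>
    have "inv\<^bsub>G\<^esub> x \<otimes>\<^bsub>G\<^esub> (x \<otimes>\<^bsub>G\<^esub> y) = y" "inv\<^bsub>G\<^esub> y \<otimes>\<^bsub>G\<^esub> (x \<otimes>\<^bsub>G\<^esub> y) = x"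
      using xy by (simp_all add: m_assoc[symmetric]) (simp add: m_comm[of _ x] m_assoc)
    then show ?thesis
      using invariant[of "inv\<^bsub>G\<^esub> x" "inv\<^bsub>G\<^esub> y" "x \<otimes>\<^bsub>G\<^esub> y"] xy commute by simp
  qed
  have "right_translations_isometric ?H d"
    unfolding right_translations_isometric_def isometry_of_def
  proof (intro ballI conjI)
    fix h assume h: "h \<in> carrier ?H"
    show "bij_betw (\<lambda>x. x \<otimes>\<^bsub>?H\<^esub> h) (carrier ?H) (carrier ?H)"
      by (rule bij_betw_byWitness[where f' = "\<lambda>x. x \<otimes>\<^bsub>?H\<^esub> inv\<^bsub>?H\<^esub> h"])
        (use h in \<open>auto simp: H.m_assoc\<close>)
    fix x y assume "x \<in> carrier ?H" "y \<in> carrier ?H"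
    then show "d (x \<otimes>\<^bsub>?H\<^esub> h) (y \<otimes>\<^bsub>?H\<^esub> h) = d x y"
      using h by (simp add: dihedral_twist_def invariant d_inv)
  qed
  then have "?H \<cong> G" using unique H.is_group carrier by blast
  then have "G \<cong> ?H" by (rule H.iso_sym)
  then have "comm_group ?H" by (rule iso_imp_comm_group) (rule H.is_monoid)
  then have "k \<otimes>\<^bsub>?H\<^esub> g = g \<otimes>\<^bsub>?H\<^esub> k"
    using g k carrier by (simp add: comm_group_def comm_monoid.m_comm)
  then have "inv\<^bsub>G\<^esub> k \<otimes>\<^bsub>G\<^esub> g = k \<otimes>\<^bsub>G\<^esub> g"
    using g k by (simp add: dihedral_twist_def m_comm)
  then have "inv\<^bsub>G\<^esub> k = k" using g k by simp
  then show False using k r_inv[of k] by simp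
qed

section \<open>The p-adic integers\<close>

lemma padic_int_carrier_iff:
  "x \<in> carrier (padic_int_group p) \<longleftrightarrow>
     (\<forall>n. x n \<in> {0..<int p ^ n} \<and> x (Suc n) mod int p ^ n = x n)"
  by (simp add: padic_int_group_def)

lemma padic_int_mult: "x \<otimes>\<^bsub>padic_int_group p\<^esub> y = (\<lambda>n. (x n + y n) mod int p ^ n)"
  by (simp add: padic_int_group_def)

lemma padic_int_one: "\<one>\<^bsub>padic_int_group p\<^esub> = (\<lambda>n. 0)"
  by (simp add: padic_int_group_def)

lemma mod_power_Suc_mod_power: "(a :: int) mod int p ^ Suc n mod int p ^ n = a mod int p ^ n"
  by (rule mod_mod_cancel) simp

lemma padic_int_constant:
  assumes "p > 0"
  shows "(\<lambda>n. a mod int p ^ n) \<in> carrier (padic_int_group p)"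
  using assms by (simp add: padic_int_carrier_iff mod_power_Suc_mod_power del: power_Suc)

lemma padic_int_lepoll_real: "carrier (padic_int_group p) \<lesssim> (UNIV :: real set)"
proof -
  \<comment> \<open>A sequence is determined by its graph, coded as a set of natural numbers.\<close>
  have "inj_on (\<lambda>x. range (\<lambda>n. prod_encode (n, nat (x n)))) (carrier (padic_int_group p))"
  proof (rule inj_onI, rule ext)
    fix x y n
    assume x: "x \<in> carrier (padic_int_group p)" and y: "y \<in> carrier (padic_int_group p)"
      and eq: "range (\<lambda>n. prod_encode (n, nat (x n))) = range (\<lambda>n. prod_encode (n, nat (y n)))"
    have "prod_encode (n, nat (x n)) \<in> range (\<lambda>n. prod_encode (n, nat (y n)))"
      unfolding eq[symmetric] by blast
    then have "nat (x n) = nat (y n)" by (auto simp: prod_encode_eq)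
    then show "x n = y n" using x y by (simp add: padic_int_carrier_iff nat_eq_iff)
  qed
  then have "carrier (padic_int_group p) \<lesssim> (UNIV :: nat set set)"
    unfolding lepoll_def by blast
  then show ?thesis using nat_sets_eqpoll_reals lepoll_trans1 eqpoll_imp_lepoll lepoll_trans by blast
qed

lemma cancel_2_mod_odd_power:
  assumes "odd p" "(2 * a) mod int p ^ n = (2 * b) mod int p ^ n"
  shows "a mod int p ^ n = b mod int p ^ n"
proof -
  have "int p ^ n dvd 2 * (a - b)"
    using assms(2) by (simp add: mod_eq_dvd_iff right_diff_distrib)
  moreover have "coprime (int p ^ n) 2" using assms(1) by simp
  ultimately show ?thesis by (simp only: mod_eq_dvd_iff coprime_dvd_mult_right_iff)
qed

lemma padic_int_no_involution:
  assumes "odd p" and x: "x \<in> carrier (padic_int_group p)"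
    and "x \<otimes>\<^bsub>padic_int_group p\<^esub> x = \<one>\<^bsub>padic_int_group p\<^esub>"
  shows "x = \<one>\<^bsub>padic_int_group p\<^esub>"
proof -
  have "x n = 0" for n
  proof -
    have "(2 * x n) mod int p ^ n = (2 * 0) mod int p ^ n"
      using fun_cong[OF assms(3), of n] by (simp add: padic_int_mult padic_int_one)
    then have "x n mod int p ^ n = 0 mod int p ^ n" by (rule cancel_2_mod_odd_power[OF \<open>odd p\<close>])
    then show ?thesis using x by (simp add: padic_int_carrier_iff)
  qed
  then show ?thesis by (simp add: padic_int_one fun_eq_iff)
qed

text \<open>
  At level \<open>n\<close> the inverse of 2 is the residue of \<open>(p^n + 1) / 2\<close>. These residues are compatible
  because both sides agree after doubling, and 2 can be cancelled modulo an odd number.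
\<close>
lemma padic_int_half:
  assumes "odd p" and c: "c \<in> carrier (padic_int_group p)"
  shows "\<exists>y\<in>carrier (padic_int_group p). y \<otimes>\<^bsub>padic_int_group p\<^esub> y = c"
proof -
  define h where "h n = (int p ^ n + 1) div 2" for n
  have h: "2 * h n = int p ^ n + 1" for n
    unfolding h_def by (rule dvd_mult_div_cancel) (use \<open>odd p\<close> in simp)
  define y where "y n = (h n * c n) mod int p ^ n" for n
  have p_pos: "int p ^ n > 0" for n using \<open>odd p\<close> by (simp add: odd_pos)
  have c_range: "c n mod int p ^ n = c n" and c_Suc: "c (Suc n) mod int p ^ n = c n" for n
    using c by (simp_all add: padic_int_carrier_iff)
  have twice: "(2 * (h m * a)) mod int p ^ n = a mod int p ^ n" if "n \<le> m" for a m n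
  proof -
    have "2 * (h m * a) = a + int p ^ n * (int p ^ (m - n) * a)"
      using h[of m] that by (simp add: algebra_simps flip: power_add)
    then show ?thesis by simp
  qed
  have "y (Suc n) mod int p ^ n = y n" for n
  proof -
    have "(h (Suc n) * c (Suc n)) mod int p ^ n = (h n * c n) mod int p ^ n"
      by (rule cancel_2_mod_odd_power[OF \<open>odd p\<close>]) (simp add: twice c_Suc c_range)
    then show ?thesis unfolding y_def mod_power_Suc_mod_power .
  qed
  then have "y \<in> carrier (padic_int_group p)"
    using p_pos by (simp add: padic_int_carrier_iff y_def)
  moreover have "(y n + y n) mod int p ^ n = c n" for n
    using twice[OF order_refl, of n "c n"] unfolding y_def mod_add_eq c_range mult_2 .
  ultimately show ?thesis by (auto simp: padic_int_mult)
qed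

text \<open>
  The even 2-adic integers have index two, and 2 is among them without being its own negative.
\<close>
lemma not_natural_group_2adic: "\<not> natural_group (padic_int_group 2)"
proof -
  let ?G = "padic_int_group 2"
  interpret comm_group ?G by (rule comm_group_padic_int_group) simp
  define K where "K = {x \<in> carrier ?G. x 1 = 0}"
  have one_digit: "x 1 = 0 \<or> x 1 = 1" if "x \<in> carrier ?G" for x
    using that by (auto simp: padic_int_carrier_iff dest!: spec[of _ 1])
  have inv_digit: "inv\<^bsub>?G\<^esub> x \<in> K" if "x \<in> K" for x
  proof -
    have x: "x \<in> carrier ?G" "x 1 = 0" using that by (auto simp: K_def)
    have "(inv\<^bsub>?G\<^esub> x \<otimes>\<^bsub>?G\<^esub> x) 1 = 0" using x by (simp add: padic_int_one)
    then have "(inv\<^bsub>?G\<^esub> x) 1 mod 2 = 0" using x by (simp add: padic_int_mult)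
    then show ?thesis using one_digit[of "inv\<^bsub>?G\<^esub> x"] x by (auto simp: K_def)
  qed
  show ?thesis
  proof (rule not_natural_group_if_index_2_subgroup[of ?G K "\<lambda>n. 1 mod int 2 ^ n" "\<lambda>n. 2 mod int 2 ^ n"])
    show "comm_group ?G" by (rule comm_group_padic_int_group) simp
    show "subgroup K ?G"
    proof (rule subgroupI)
      show "K \<noteq> {}" using one_closed by (auto simp: K_def padic_int_one)
      show "x \<otimes>\<^bsub>?G\<^esub> y \<in> K" if "x \<in> K" "y \<in> K" for x y
        using that m_closed[of x y] by (simp add: K_def padic_int_mult)
    qed (use inv_digit in \<open>auto simp: K_def\<close>)
    show "x \<otimes>\<^bsub>?G\<^esub> y \<in> K" if "x \<in> carrier ?G - K" "y \<in> carrier ?G - K" for x y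
      using that m_closed[of x y] one_digit[of x] one_digit[of y]
      by (auto simp: K_def padic_int_mult)
    show "(\<lambda>n. 1 mod int 2 ^ n) \<in> carrier ?G - K"
      using padic_int_constant[of 2 1] by (simp add: K_def)
    show "(\<lambda>n. 2 mod int 2 ^ n) \<in> K"
      using padic_int_constant[of 2 2] by (simp add: K_def)
    \<comment> \<open>The double of 2 first differs from 0 modulo 8.\<close>
    show "(\<lambda>n. 2 mod int 2 ^ n) \<otimes>\<^bsub>?G\<^esub> (\<lambda>n. 2 mod int 2 ^ n) \<noteq> \<one>\<^bsub>?G\<^esub>"
      by (auto simp: padic_int_mult padic_int_one fun_eq_iff intro!: exI[of _ 3])
  qed
qed

theorem theorem13:
  fixes p :: nat
  assumes "prime p"
  shows "natural_group (padic_int_group p) \<longleftrightarrow> odd p"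
proof
  assume natural: "natural_group (padic_int_group p)"
  show "odd p"
  proof
    assume "even p"
    then have "p = 2" using primes_dvd_imp_eq[OF two_is_prime_nat assms] by simp
    with natural show False using not_natural_group_2adic by simp
  qed
next
  assume "odd p"
  show "natural_group (padic_int_group p)"
  proof (rule natural_group_if_uniquely_2_divisible)
    show "comm_group (padic_int_group p)"
      using \<open>odd p\<close> by (intro comm_group_padic_int_group odd_pos)
  qed (simp_all add: padic_int_lepoll_real padic_int_no_involution padic_int_half \<open>odd p\<close>)
qed

end
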